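(* Let $\mathcal{G}=(\mathcal{N},\mathcal{E})$ be a directed graph with node set $\mathcal{N}=\{1,\dots,n\}$, with matrix $P$ and dangling-node vector $\mathbf{d}$ as defined in the context, let $\alpha\in(0,1)$ be a fixed damping factor and $\mathbf{u}\in\mathbb{R}^n$ a fixed dangling node distribution ($\mathbf{u}>0$, $\mathbf{u}^T\mathbf{e}=1$). Let $X=(x_{pq})=(1-\alpha)\bigl(I_n-\alpha(P+\mathbf{d}\mathbf{u}^T)\bigr)^{-1}$. Then the leadership group of $\mathcal{G}$ equals the set of nodes $i\in\mathcal{N}$ for which there exists $j\in\mathcal{N}$ such that $x_{ji}>x_{jk}$ for every $k\in\mathcal{N}$ with $k\ne i$.
   Context: The adjacency matrix $A=(a_{ij})$ of $\mathcal{G}$ has $a_{ij}=1$ if $(i,j)\in\mathcal{E}$ and $0$ otherwise; $k_{out}(i)=\sum_k a_{ik}$. A node $i$ is dangling if $k_{out}(i)=0$. The matrix $P=(p_{ij})$ has $p_{ij}=0$ for all $j$ if $i$ is dangling, and $p_{ij}=a_{ij}/k_{out}(i)$ otherwise. $\mathbf{d}\in\mathbb{R}^n$ has $d_i=1$ if $i$ is dangling and $d_i=0$ otherwise. $\mathbf{e}_1,\dots,\mathbf{e}_n$ are the standard basis column vectors and $\mathbf{e}=(1,\dots,1)^T$; $\mathbf{v}>0$ means all components are positive. A personalization vector is $\mathbf{v}\in\mathbb{R}^n$ with $\mathbf{v}>0$, $\mathbf{v}^T\mathbf{e}=1$. The Google matrix is $G=\alpha(P+\mathbf{d}\mathbf{u}^T)+(1-\alpha)\mathbf{e}\mathbf{v}^T$,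 and the personalized PageRank vector $\pi(\mathbf{v})$ is the unique vector with $\pi(\mathbf{v})>0$, $\pi(\mathbf{v})^T\mathbf{e}=1$, $\pi(\mathbf{v})^TG=\pi(\mathbf{v})^T$; equivalently $\pi(\mathbf{v})^T=\mathbf{v}^TX$. A node $i$ is a leader of $\mathcal{G}$ if there exists a personalization vector $\mathbf{v}$ such that $\pi(\mathbf{v})^T\mathbf{e}_i>\pi(\mathbf{v})^T\mathbf{e}_j$ for every node $j\ne i$; the leadership group is the set of all leaders. *)

theory Defs
  imports "HOL-Analysis.Analysis"
begin

text \<open>
  A directed graph on \<open>n\<close> nodes is a set of edges over a finite node type \<open>'n\<close> with
  \<open>n = CARD('n)\<close>; loops are allowed. The component \<open>A $ i $ j\<close> is the entry in row \<open>i\<close>, column \<open>j\<close>.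
\<close>

definition adjacency :: "('n::finite \<times> 'n) set \<Rightarrow> real^'n^'n" where
  "adjacency E = (\<chi> i j. if (i, j) \<in> E then 1 else 0)"

definition k_out :: "('n::finite \<times> 'n) set \<Rightarrow> 'n \<Rightarrow> real" where
  "k_out E i = (\<Sum>k\<in>UNIV. adjacency E $ i $ k)"

definition dangling :: "('n::finite \<times> 'n) set \<Rightarrow> 'n \<Rightarrow> bool" where
  "dangling E i \<longleftrightarrow> k_out E i = 0"

definition link_matrix :: "('n::finite \<times> 'n) set \<Rightarrow> real^'n^'n" where
  "link_matrix E = (\<chi> i j. if dangling E i then 0 else adjacency E $ i $ j / k_out E i)"

definition dangling_vec :: "('n::finite \<times> 'n) set \<Rightarrow> real^'n" where
  "dangling_vec E = (\<chi> i. if dangling E i then 1 else 0)"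

definition ones :: "real^'n::finite" where
  "ones = (\<chi> i. 1)"

definition outer :: "real^'n::finite \<Rightarrow> real^'n \<Rightarrow> real^'n^'n" where
  "outer x y = (\<chi> i j. x $ i * y $ j)"

definition positive_vec :: "real^'n::finite \<Rightarrow> bool" where
  "positive_vec x \<longleftrightarrow> (\<forall>i. x $ i > 0)"

text \<open>Personalization vectors and dangling node distributions satisfy the same conditions.\<close>

definition positive_distribution :: "real^'n::finite \<Rightarrow> bool" where
  "positive_distribution x \<longleftrightarrow> positive_vec x \<and> x \<bullet> ones = 1"

definition google_matrix ::
  "('n::finite \<times> 'n) set \<Rightarrow> real \<Rightarrow> real^'n \<Rightarrow> real^'n \<Rightarrow> real^'n^'n" where
  "google_matrix E \<alpha> u v =
     \<alpha> *\<^sub>R (link_matrix E + outer (dangling_vec E) u) + (1 - \<alpha>) *\<^sub>R outer ones v"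

definition pagerank ::
  "('n::finite \<times> 'n) set \<Rightarrow> real \<Rightarrow> real^'n \<Rightarrow> real^'n \<Rightarrow> real^'n" where
  "pagerank E \<alpha> u v =
     (THE p. positive_vec p \<and> p \<bullet> ones = 1 \<and> p v* google_matrix E \<alpha> u v = p)"

definition leader ::
  "('n::finite \<times> 'n) set \<Rightarrow> real \<Rightarrow> real^'n \<Rightarrow> 'n \<Rightarrow> bool" where
  "leader E \<alpha> u i \<longleftrightarrow>
     (\<exists>v. positive_distribution v \<and>
        (\<forall>j. j \<noteq> i \<longrightarrow> pagerank E \<alpha> u v $ i > pagerank E \<alpha> u v $ j))"

definition leadership_group ::
  "('n::finite \<times> 'n) set \<Rightarrow> real \<Rightarrow> real^'n \<Rightarrow> 'n set" where
  "leadership_group E \<alpha> u = {i. leader E \<alpha> u i}"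

end

theory Submission
  imports Defs
begin

text \<open>
  Write \<open>M = P + d u\<^sup>T\<close>, a row-stochastic matrix, and \<open>Y = (I - \<alpha> M)\<^sup>-\<^sup>1\<close>, so that
  \<open>\<pi>(v)\<^sup>T = v\<^sup>T X\<close> with \<open>X = (1 - \<alpha>) Y\<close>. A maximum principle for \<open>I - \<alpha> M\<close> gives
  \<open>Y\<^sub>j\<^sub>i Y\<^sub>i\<^sub>k \<le> Y\<^sub>j\<^sub>k Y\<^sub>i\<^sub>i\<close> for all \<open>i, j, k\<close>. If row \<open>i\<close> of \<open>X\<close> does not have its strict maximum
  at \<open>i\<close>, say \<open>X\<^sub>i\<^sub>k \<ge> X\<^sub>i\<^sub>i\<close>, then \<open>X\<^sub>j\<^sub>k \<ge> X\<^sub>j\<^sub>i\<close> for every \<open>j\<close>, hence \<open>\<pi>(v)\<^sub>k \<ge> \<pi>(v)\<^sub>i\<close> for every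
  \<open>v\<close>, and \<open>i\<close> is no leader. Conversely, if row \<open>j\<close> has its strict maximum at \<open>i\<close>, then \<open>i\<close> wins
  for every personalization vector close enough to \<open>e\<^sub>j\<close>.
\<close>

section \<open>Matrix inverses and products\<close>

lemma matrix_inv_mult:
  fixes A :: "'a::semiring_1^'n^'m"
  assumes "invertible A"
  shows "A ** matrix_inv A = mat 1" "matrix_inv A ** A = mat 1"
proof -
  have "\<exists>B. A ** B = mat 1 \<and> B ** A = mat 1"
    using assms by (simp add: invertible_def)
  then have "A ** matrix_inv A = mat 1 \<and> matrix_inv A ** A = mat 1"
    unfolding matrix_inv_def by (rule someI_ex)
  then show "A ** matrix_inv A = mat 1" "matrix_inv A ** A = mat 1"
    by auto
qed

lemma matrix_vector_mult_ones: "(A *v ones) $ i = (\<Sum>j\<in>UNIV. A $ i $ j)"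
  by (simp add: matrix_vector_mult_def ones_def)

lemma vector_matrix_mult_outer: "x v* outer y z = (x \<bullet> y) *\<^sub>R z"
  by (simp add: vec_eq_iff vector_matrix_mult_def outer_def inner_vec_def sum_distrib_left mult_ac)

lemma vector_matrix_mult_nth: "(x v* A) $ k = (\<Sum>j\<in>UNIV. x $ j * A $ j $ k)"
  for x :: "real^'n"
  by (simp add: vector_matrix_mult_def mult.commute)

section \<open>The resolvent of a damped row-stochastic matrix\<close>

locale damped_stochastic =
  fixes M :: "real^'n^'n" and \<alpha> :: real
  assumes damping: "0 < \<alpha>" "\<alpha> < 1"
    and nonneg: "\<And>i j. M $ i $ j \<ge> 0"
    and row_sums: "M *v ones = ones"
begin

definition resolvent :: "real^'n^'n" where
  "resolvent = matrix_inv (mat 1 - \<alpha> *\<^sub>R M)"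

lemma row_sum: "(\<Sum>j\<in>UNIV. M $ i $ j) = 1"
  using arg_cong[OF row_sums, of "\<lambda>x. x $ i"]
  by (simp add: matrix_vector_mult_ones) (simp add: ones_def)

lemma mult_nth: "((mat 1 - \<alpha> *\<^sub>R M) *v z) $ j = z $ j - \<alpha> * (\<Sum>k\<in>UNIV. M $ j $ k * z $ k)"
  by (simp add: matrix_vector_mult_diff_rdistrib scaleR_matrix_vector_assoc[symmetric])
    (simp add: matrix_vector_mult_def)

text \<open>At a minimal entry \<open>z $ m < 0\<close>, the \<open>M\<close>-average of
  \<open>z\<close> is at least \<open>z $ m\<close>, so a nonnegative residual there forces
  \<open>(1 - \<alpha>) * z $ m \<ge> 0\<close>, a contradiction. The disjunction leaves the
  residual free wherever \<open>z\<close> is already known to be nonnegative.\<close>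

lemma maximum_principle:
  assumes "\<And>j. ((mat 1 - \<alpha> *\<^sub>R M) *v z) $ j \<ge> 0 \<or> z $ j \<ge> 0"
  shows "z $ i \<ge> 0"
proof -
  have "Min (range (($) z)) \<in> range (($) z)"
    by (rule Min_in) auto
  then obtain m where m: "Min (range (($) z)) = z $ m"
    by (rule rangeE)
  have min: "z $ m \<le> z $ k" for k
    unfolding m[symmetric] by (rule Min_le) auto
  have "z $ m \<ge> 0"
  proof (cases "z $ m \<ge> 0")
    case False
    have "z $ m = (\<Sum>k\<in>UNIV. M $ m $ k * z $ m)"
      by (simp add: sum_distrib_right[symmetric] row_sum)
    also have "\<dots> \<le> (\<Sum>k\<in>UNIV. M $ m $ k * z $ k)"
      by (intro sum_mono mult_left_mono min nonneg)
    finally have "\<alpha> * z $ m \<le> \<alpha> * (\<Sum>k\<in>UNIV. M $ m $ k * z $ k)"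
      using damping by (intro mult_left_mono) auto
    also have "\<dots> \<le> z $ m"
      using assms[of m] False by (simp add: mult_nth)
    finally have "(1 - \<alpha>) * z $ m \<ge> 0"
      by (simp add: algebra_simps)
    then show ?thesis
      using damping by (simp add: zero_le_mult_iff)
  qed
  then show ?thesis
    using min[of i] by linarith
qed

lemma invertible: "invertible (mat 1 - \<alpha> *\<^sub>R M)"
proof -
  have "x = 0" if x: "(mat 1 - \<alpha> *\<^sub>R M) *v x = 0" for x
  proof -
    \<comment> \<open>The maximum principle for both \<open>x\<close> and \<open>- x\<close> makes
      the kernel trivial.\<close>
    have "(mat 1 - \<alpha> *\<^sub>R M) *v (- x) = 0"
      using matrix_vector_mult_scaleR[of "mat 1 - \<alpha> *\<^sub>R M" "-1" x] x by simp
    then have "(- x) $ i \<ge> 0" for i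
      by (intro maximum_principle) simp
    moreover have "x $ i \<ge> 0" for i
      using x by (intro maximum_principle) simp
    ultimately show ?thesis
      by (auto simp: vec_eq_iff intro: antisym)
  qed
  then show ?thesis
    by (simp add: invertible_left_inverse matrix_left_invertible_ker)
qed

lemmas mult_resolvent = matrix_inv_mult(1)[OF invertible, folded resolvent_def]
  and resolvent_mult = matrix_inv_mult(2)[OF invertible, folded resolvent_def]

lemma mult_resolvent_column:
  "(mat 1 - \<alpha> *\<^sub>R M) *v column k resolvent = axis k 1"
  by (metis matrix_vector_mul_assoc matrix_vector_mult_basis matrix_vector_mul_lid mult_resolvent)

lemma resolvent_nonneg: "resolvent $ j $ k \<ge> 0"
proof -
  have "column k resolvent $ j \<ge> 0"
    by (rule maximum_principle) (simp add: mult_resolvent_column axis_def)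
  then show ?thesis
    by (simp add: column_def)
qed

lemma resolvent_diag_pos: "resolvent $ i $ i > 0"
proof -
  have "resolvent $ i $ i - \<alpha> * (\<Sum>k\<in>UNIV. M $ i $ k * resolvent $ k $ i) = 1"
    using arg_cong[OF mult_resolvent_column[of i], of "\<lambda>x. x $ i"]
    by (simp add: mult_nth) (simp add: column_def axis_def)
  moreover have "\<alpha> * (\<Sum>k\<in>UNIV. M $ i $ k * resolvent $ k $ i) \<ge> 0"
    using damping by (intro mult_nonneg_nonneg sum_nonneg nonneg resolvent_nonneg) auto
  ultimately show ?thesis
    by linarith
qed

text \<open>\<open>ones\<close> is an eigenvector of \<open>mat 1 - \<alpha> *\<^sub>R M\<close> for
  the eigenvalue \<open>1 - \<alpha>\<close>. This is what keeps the total mass of PageRank equal to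
  1.\<close>

lemma resolvent_ones: "(1 - \<alpha>) *\<^sub>R (resolvent *v ones) = ones"
proof -
  have "(mat 1 - \<alpha> *\<^sub>R M) *v ones = (1 - \<alpha>) *\<^sub>R ones"
    by (simp add: matrix_vector_mult_diff_rdistrib scaleR_matrix_vector_assoc[symmetric]
        row_sums scaleR_diff_left)
  then have "resolvent *v ((1 - \<alpha>) *\<^sub>R ones) = ones"
    by (metis matrix_vector_mul_assoc matrix_vector_mul_lid resolvent_mult)
  then show ?thesis
    by (simp add: matrix_vector_mult_scaleR)
qed

text \<open>
  In terms of the Markov chain that moves by \<open>M\<close> and is killed at rate \<open>1 - \<alpha>\<close>, the ratio
  \<open>Y\<^sub>j\<^sub>i / Y\<^sub>i\<^sub>i\<close> is the probability of reaching \<open>i\<close> from \<open>j\<close>, and the lemma counts only those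
  visits to \<open>k\<close> that come after a visit to \<open>i\<close>.
\<close>

lemma resolvent_mult_le:
  "resolvent $ j $ i * resolvent $ i $ k \<le> resolvent $ j $ k * resolvent $ i $ i"
proof -
  \<comment> \<open>The combination is chosen to vanish at \<open>i\<close>, the one coordinate
    where its residual may be negative.\<close>
  define z where "z = resolvent $ i $ i *\<^sub>R column k resolvent - resolvent $ i $ k *\<^sub>R column i resolvent"
  have "(mat 1 - \<alpha> *\<^sub>R M) *v z = resolvent $ i $ i *\<^sub>R axis k 1 - resolvent $ i $ k *\<^sub>R axis i 1"
    by (simp add: z_def matrix_vector_mult_diff_distrib matrix_vector_mult_scaleR
        mult_resolvent_column)
  then have "((mat 1 - \<alpha> *\<^sub>R M) *v z) $ l \<ge> 0" if "l \<noteq> i" for l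
    using that resolvent_nonneg by (simp add: axis_def)
  moreover have "z $ i = 0"
    by (simp add: z_def column_def)
  ultimately have "z $ j \<ge> 0"
    by (metis maximum_principle order_refl)
  then show ?thesis
    by (simp add: z_def column_def mult.commute)
qed

lemma resolvent_row_mono:
  assumes "resolvent $ i $ i \<le> resolvent $ i $ k"
  shows "resolvent $ j $ i \<le> resolvent $ j $ k"
proof -
  have "resolvent $ j $ i * resolvent $ i $ i \<le> resolvent $ j $ i * resolvent $ i $ k"
    using assms resolvent_nonneg by (rule mult_left_mono)
  also have "\<dots> \<le> resolvent $ j $ k * resolvent $ i $ i"
    by (rule resolvent_mult_le)
  finally show ?thesis
    using resolvent_diag_pos[of i] by simp
qed

text \<open>The normalization of \<open>p\<close> collapses the rank-one term to
  \<open>(1 - \<alpha>) *\<^sub>R v\<close>. The eigenvector equation becomes an invertible linear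
  system, which yields existence and uniqueness at once.\<close>

lemma stationary_iff:
  assumes "p \<bullet> ones = 1"
  shows "p v* (\<alpha> *\<^sub>R M + (1 - \<alpha>) *\<^sub>R outer ones v) = p \<longleftrightarrow> p = v v* ((1 - \<alpha>) *\<^sub>R resolvent)"
proof -
  have "p v* (\<alpha> *\<^sub>R M + (1 - \<alpha>) *\<^sub>R outer ones v) = \<alpha> *\<^sub>R (p v* M) + (1 - \<alpha>) *\<^sub>R v"
    by (simp add: vector_matrix_mult_add_rdistrib vector_scaleR_matrix_ac vector_matrix_mult_outer assms)
  also have "\<dots> = p \<longleftrightarrow> p v* (mat 1 - \<alpha> *\<^sub>R M) = (1 - \<alpha>) *\<^sub>R v"
  proof -
    have "p v* (mat 1 - \<alpha> *\<^sub>R M) = p - \<alpha> *\<^sub>R (p v* M)"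
      by (simp add: vector_matrix_mult_diff_rdistrib vector_scaleR_matrix_ac)
    then show ?thesis
      by (auto simp: algebra_simps)
  qed
  also have "\<dots> \<longleftrightarrow> p = ((1 - \<alpha>) *\<^sub>R v) v* resolvent"
  proof
    assume "p v* (mat 1 - \<alpha> *\<^sub>R M) = (1 - \<alpha>) *\<^sub>R v"
    then have "(p v* (mat 1 - \<alpha> *\<^sub>R M)) v* resolvent = ((1 - \<alpha>) *\<^sub>R v) v* resolvent"
      by simp
    then show "p = ((1 - \<alpha>) *\<^sub>R v) v* resolvent"
      by (simp add: vector_matrix_mul_assoc mult_resolvent)
  qed (simp add: vector_matrix_mul_assoc resolvent_mult)
  also have "((1 - \<alpha>) *\<^sub>R v) v* resolvent = v v* ((1 - \<alpha>) *\<^sub>R resolvent)"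
    by (simp add: vector_scaleR_matrix_ac scaleR_vector_matrix_assoc)
  finally show ?thesis .
qed

lemma positive_distribution_mult_resolvent:
  assumes "positive_distribution v"
  shows "positive_distribution (v v* ((1 - \<alpha>) *\<^sub>R resolvent))"
proof -
  have "(v v* ((1 - \<alpha>) *\<^sub>R resolvent)) $ i > 0" for i
  proof -
    have "(\<Sum>j\<in>UNIV. v $ j * ((1 - \<alpha>) *\<^sub>R resolvent) $ j $ i) > 0"
    proof (rule sum_pos2[where i = i])
      show "0 < v $ i * ((1 - \<alpha>) *\<^sub>R resolvent) $ i $ i"
        using assms damping resolvent_diag_pos
        by (simp add: positive_distribution_def positive_vec_def)
      show "0 \<le> v $ j * ((1 - \<alpha>) *\<^sub>R resolvent) $ j $ i" for j
        using assms damping resolvent_nonneg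
        by (simp add: positive_distribution_def positive_vec_def less_imp_le)
    qed auto
    then show ?thesis
      by (simp only: vector_matrix_mult_nth)
  qed
  moreover have "(v v* ((1 - \<alpha>) *\<^sub>R resolvent)) \<bullet> ones = 1"
    using assms
    by (simp add: dot_lmul_matrix scaleR_matrix_vector_assoc[symmetric] resolvent_ones
        positive_distribution_def)
  ultimately show ?thesis
    by (simp add: positive_distribution_def positive_vec_def)
qed

end

section \<open>The Google matrix and its PageRank vector\<close>

lemma link_matrix_nonneg: "link_matrix E $ i $ j \<ge> 0"
  by (simp add: link_matrix_def k_out_def adjacency_def sum_nonneg)

lemma damped_stochastic_link_matrix:
  assumes "0 < \<alpha>" "\<alpha> < 1" "positive_distribution u"
  shows "damped_stochastic (link_matrix E + outer (dangling_vec E) u) \<alpha>"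
proof
  show "(link_matrix E + outer (dangling_vec E) u) $ i $ j \<ge> 0" for i j
    using assms(3) link_matrix_nonneg[of E i j]
    by (simp add: outer_def dangling_vec_def positive_distribution_def positive_vec_def less_imp_le)
  have u: "(\<Sum>j\<in>UNIV. u $ j) = 1"
    using assms(3) by (simp add: positive_distribution_def inner_vec_def ones_def)
  show "(link_matrix E + outer (dangling_vec E) u) *v ones = ones"
  proof (simp only: vec_eq_iff matrix_vector_mult_ones, intro allI)
    fix i
    have "(\<Sum>j\<in>UNIV. (link_matrix E + outer (dangling_vec E) u) $ i $ j) =
        (\<Sum>j\<in>UNIV. link_matrix E $ i $ j) + dangling_vec E $ i"
      by (simp add: outer_def sum.distrib sum_distrib_left[symmetric] u)
    also have "\<dots> = 1"
      \<comment> \<open>A dangling row is zero in \<open>link_matrix E\<close> and receives its mass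
        from \<open>u\<close>; every other row is already normalized by its out-degree.\<close>
      by (cases "dangling E i")
        (simp_all add: link_matrix_def dangling_vec_def sum_divide_distrib[symmetric]
          k_out_def[symmetric], simp add: dangling_def)
    finally show "(\<Sum>j\<in>UNIV. (link_matrix E + outer (dangling_vec E) u) $ i $ j) = ones $ i"
      by (simp add: ones_def)
  qed
qed (use assms in auto)

lemma pagerank_eq:
  assumes "0 < \<alpha>" "\<alpha> < 1" "positive_distribution u" "positive_distribution v"
  shows "pagerank E \<alpha> u v = v v* ((1 - \<alpha>) *\<^sub>R
    matrix_inv (mat 1 - \<alpha> *\<^sub>R (link_matrix E + outer (dangling_vec E) u)))"
proof -
  interpret damped_stochastic "link_matrix E + outer (dangling_vec E) u" \<alpha>
    by (rule damped_stochastic_link_matrix) (use assms in auto)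
  show ?thesis
    unfolding pagerank_def google_matrix_def resolvent_def[symmetric]
    using positive_distribution_mult_resolvent[OF assms(4)] stationary_iff
    by (intro the_equality) (auto simp: positive_distribution_def)
qed

section \<open>Leaders and the rows of \<open>X\<close>\<close>

lemma exists_positive_distribution_near_axis:
  fixes X :: "real^'n^'n"
  assumes "\<And>k. k \<noteq> i \<Longrightarrow> X $ j $ i > X $ j $ k"
  shows "\<exists>v. positive_distribution v \<and> (\<forall>k. k \<noteq> i \<longrightarrow> (v v* X) $ i > (v v* X) $ k)"
proof -
  \<comment> \<open>The product of \<open>axis j 1\<close> with \<open>X\<close> is row
    \<open>j\<close>, but a basis vector need not be positive. Mixing in a little of the uniform
    distribution makes it so.\<close>
  define v :: "real \<Rightarrow> real^'n" where
    "v t = (1 - t) *\<^sub>R axis j 1 + (t / real CARD('n)) *\<^sub>R ones" for t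
  have v: "positive_distribution (v t)" if "0 < t" "t < 1" for t
  proof -
    have "v t $ k > 0" for k
      using that by (auto simp: v_def axis_def ones_def add_pos_pos)
    moreover have "v t \<bullet> ones = 1"
    proof -
      have "axis j 1 \<bullet> (ones :: real^'n) = 1" "ones \<bullet> (ones :: real^'n) = real CARD('n)"
        by (simp_all add: inner_axis' ones_def, simp add: inner_vec_def)
      then show ?thesis
        by (simp add: v_def inner_add_left)
    qed
    ultimately show ?thesis
      by (simp add: positive_distribution_def positive_vec_def)
  qed
  have lim: "((\<lambda>t. (v t v* X) $ k) \<longlongrightarrow> X $ j $ k) (at_right 0)" for k
  proof -
    have "((\<lambda>t. (v t v* X) $ k) \<longlongrightarrow> (v 0 v* X) $ k) (at_right 0)"
      unfolding v_def vector_matrix_mult_nth by (intro tendsto_intros) simp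
    also have "(v 0 v* X) $ k = X $ j $ k"
      by (simp add: v_def vector_matrix_mult_nth axis_def if_distrib if_distribR cong: if_cong)
    finally show ?thesis .
  qed
  have "\<forall>\<^sub>F t in at_right 0. (v t v* X) $ k < (v t v* X) $ i" if "k \<noteq> i" for k
  proof -
    have "((\<lambda>t. (v t v* X) $ i - (v t v* X) $ k) \<longlongrightarrow> X $ j $ i - X $ j $ k) (at_right 0)"
      by (intro tendsto_diff lim)
    then have "\<forall>\<^sub>F t in at_right 0. (v t v* X) $ i - (v t v* X) $ k > 0"
      using assms[OF that] by (intro order_tendstoD(1)) auto
    then show ?thesis
      by simp
  qed
  \<comment> \<open>Finitely many strict inequalities, each stable under small \<open>t\<close>,
    hold together.\<close>
  then have "\<forall>\<^sub>F t in at_right 0. \<forall>k. k \<noteq> i \<longrightarrow> (v t v* X) $ k < (v t v* X) $ i"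
    by (intro eventually_all_finite) (auto simp: eventually_const_iff)
  moreover have "\<forall>\<^sub>F t in at_right (0::real). t \<in> {0<..<1}"
    by (rule eventually_at_right_real) simp
  ultimately have "\<forall>\<^sub>F t in at_right 0. positive_distribution (v t) \<and>
      (\<forall>k. k \<noteq> i \<longrightarrow> (v t v* X) $ k < (v t v* X) $ i)"
    by eventually_elim (auto intro: v)
  then show ?thesis
    using eventually_happens[of _ "at_right (0::real)"] by force
qed

theorem theorem3:
  fixes E :: "('n::finite \<times> 'n) set"
    and \<alpha> :: real
    and u :: "real^'n"
    and X :: "real^'n^'n"
  assumes "0 < \<alpha>" and "\<alpha> < 1"
    and "positive_distribution u"
    and "X = (1 - \<alpha>) *\<^sub>R
           matrix_inv (mat 1 - \<alpha> *\<^sub>R (link_matrix E + outer (dangling_vec E) u))"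
  shows "leadership_group E \<alpha> u = {i. \<exists>j. \<forall>k. k \<noteq> i \<longrightarrow> X $ j $ i > X $ j $ k}"
proof -
  interpret damped_stochastic "link_matrix E + outer (dangling_vec E) u" \<alpha>
    by (rule damped_stochastic_link_matrix) (use assms in auto)
  have X: "X = (1 - \<alpha>) *\<^sub>R resolvent"
    by (simp add: assms(4) resolvent_def)
  have pagerank: "pagerank E \<alpha> u v = v v* X" if "positive_distribution v" for v
    using pagerank_eq[OF assms(1-3) that] by (simp add: assms(4))
  have "\<exists>j. \<forall>k. k \<noteq> i \<longrightarrow> X $ j $ i > X $ j $ k" if leader: "leader E \<alpha> u i" for i
  proof -
    obtain v where v: "positive_distribution v"
      and less: "\<And>k. k \<noteq> i \<Longrightarrow> (v v* X) $ k < (v v* X) $ i"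
      using leader pagerank by (auto simp: leader_def)
    \<comment> \<open>The witness for a leader \<open>i\<close> is its own row: a failure there
      would spread to all rows and so to every positive mixture of them.\<close>
    have "X $ i $ k < X $ i $ i" if "k \<noteq> i" for k
    proof (rule ccontr)
      assume "\<not> X $ i $ k < X $ i $ i"
      then have "resolvent $ i $ i \<le> resolvent $ i $ k"
        using damping by (simp add: X)
      then have "X $ j $ i \<le> X $ j $ k" for j
        using damping resolvent_row_mono by (simp add: X)
      then have "(v v* X) $ i \<le> (v v* X) $ k"
        unfolding vector_matrix_mult_nth using v
        by (intro sum_mono mult_left_mono)
          (auto simp: positive_distribution_def positive_vec_def less_imp_le)
      then show False
        using less[OF that] by simp
    qed
    then show ?thesis
      by blast
  qed
  moreover have "leader E \<alpha> u i" if "\<And>k. k \<noteq> i \<Longrightarrow> X $ j $ i > X $ j $ k" for i j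
    using exists_positive_distribution_near_axis[of i X j] that pagerank
    by (auto simp: leader_def)
  ultimately show ?thesis
    by (auto simp: leadership_group_def)
qed

end
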